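(* Let $q$ be a prime power and let $n = n_1 + n_2 + \cdots + n_\ell$ be a sum-rank length partition into positive integers (extension degree $m=1$). Let $\mathcal{C} \subseteq \mathbb{F}_q^n$ be a linear code with $\mathrm{d}_{SR}(\mathcal{C}) \geq 3$, redundancy $r = n - \dim(\mathcal{C})$ and parity-check matrix $H = (H_1, \ldots, H_\ell) \in \mathbb{F}_q^{r\times n}$, $H_i\in\mathbb{F}_q^{r\times n_i}$. Let $\mathbf{y} = \mathbf{c} + \mathbf{e} \in \mathbb{F}_q^n$ with $\mathbf{c} \in \mathcal{C}$ and $\mathrm{wt}_{SR}(\mathbf{e}) \leq 1$. Then the following algorithm, with input $\mathbf{y}$, outputs $\mathbf{c}$: 1. Compute $\mathbf{s} = H\mathbf{y}^T \in \mathbb{F}_q^r$. If $\mathbf{s} = \mathbf{0}$, output $\mathbf{y}$ and stop. 2. For $j = 1, 2, \ldots, \ell$, until a solution is found, try to solve the linear system $H_j \mathbf{a}^T = \mathbf{s}$ in the unknown $\mathbf{a} \in \mathbb{F}_q^{n_j}$. (When $\mathbf{s}\neq\mathbf{0}$, a solution exists for exactly one index $j = i$, and for that index the solution $\mathbf{a}$ is unique.) 3. Output $\mathbf{y} - \mathbf{e}_{i,\mathbf{a}}$, where $\mathbf{e}_{i,\mathbf{a}} = (\mathbf{0},\ldots,\mathbf{0},\mathbf{a},\mathbf{0},\ldots,\mathbf{0})$ has $\mathbf{a}$ in the $i$th block of $n_i$ coordinates. The algorithm uses $\mathcal{O}(nr + \ell r^3)$ operations over $\mathbb{F}_q$. In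 the case of proper sum-rank Hamming codes with $N = n_1 = \cdots = n_\ell$ dividing $r$, this complexity is $\mathcal{O}\left( (r^3 + Nr)\frac{q^r-1}{q^N-1} \right)$.
   Context: Sum-rank metric for $m=1$: for $\mathbf{c} = (\mathbf{c}^{(1)}, \ldots, \mathbf{c}^{(\ell)}) \in \mathbb{F}_q^n$ with $\mathbf{c}^{(i)} \in \mathbb{F}_q^{n_i}$, the sum-rank weight is $\mathrm{wt}_{SR}(\mathbf{c}) = \sum_{i=1}^\ell \mathrm{Rk}(\mathbf{c}^{(i)})$, where $\mathbf{c}^{(i)}$ is viewed as a $1\times n_i$ matrix over $\mathbb{F}_q$ (so the weight is the number of nonzero blocks). For a linear code (subspace) $\mathcal{C}$, $\mathrm{d}_{SR}(\mathcal{C}) = \min\{\mathrm{wt}_{SR}(\mathbf{c}) \mid \mathbf{c} \in \mathcal{C}\setminus\{\mathbf{0}\}\}$. A parity-check matrix of a linear code $\mathcal{C}\subseteq\mathbb{F}_q^n$ of redundancy $r$ is a matrix $H \in \mathbb{F}_q^{r\times n}$ of rank $r$ with $\mathcal{C} = \{\mathbf{c} \mid H\mathbf{c}^T = \mathbf{0}\}$. Linear systems are solved by standard Gaussian elimination. Proper sum-rank Hamming code ($m=1$): a linear code $\mathcal{C} \subseteq \mathbb{F}_q^n$, $n = \ell N$ with $\ell$ blocks of length $N$, of redundancy $r = n - \dim(\mathcal{C})$, such that $\mathrm{d}_{SR}(\mathcal{C}) \geq 3$ and there is no linear code $\mathcal{C}' \subseteq \mathbb{F}_q^{n'}$ with $\mathrm{d}_{SR}(\mathcal{C}')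 \geq 3$ and $n' - \dim(\mathcal{C}') = r$ for a partition $n' = \ell' N$ into $\ell'$ blocks of the same length $N$ with $\ell' > \ell$. *)

theory Defs
  imports
    "Jordan_Normal_Form.Missing_VectorSpace"
    "HOL-Library.Extended_Nat"
    "HOL-Library.Monad_Syntax"
begin

text \<open>
  A finite field is a record \<open>F :: 'a ring\<close> with \<open>field F\<close> and a finite carrier, not a type of
  class \<open>field\<close>, so that a statement can quantify over all finite fields after it has fixed the
  constant hidden in an \<open>O\<close>-term. Every finite field is isomorphic to one with carrier
  in \<open>nat\<close>; for \<open>'a = nat\<close> such a constant is therefore uniform in the field.
  Vectors are lists, matrices are lists of rows, and blocks are numbered from 0.
\<close>

section \<open>Coordinate spaces, matrices, linear codes\<close>

definition coord_space :: "'a ring \<Rightarrow> nat \<Rightarrow> ('a, 'a list) module" where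
  "coord_space F n =
    \<lparr>carrier = {v. length v = n \<and> set v \<subseteq> carrier F},
     mult = undefined, one = undefined,
     zero = replicate n \<zero>\<^bsub>F\<^esub>,
     add = (\<lambda>v w. map2 (\<lambda>x y. x \<oplus>\<^bsub>F\<^esub> y) v w),
     smult = (\<lambda>a v. map (\<lambda>x. a \<otimes>\<^bsub>F\<^esub> x) v)\<rparr>"

definition is_matrix :: "'a ring \<Rightarrow> nat \<Rightarrow> nat \<Rightarrow> 'a list list \<Rightarrow> bool" where
  "is_matrix F r n A \<longleftrightarrow> length A = r \<and> set A \<subseteq> carrier (coord_space F n)"

definition mat_vec :: "'a ring \<Rightarrow> 'a list list \<Rightarrow> 'a list \<Rightarrow> 'a list" where
  "mat_vec F A v = map (\<lambda>row. \<Oplus>\<^bsub>F\<^esub>k\<in>{..<length v}. row ! k \<otimes>\<^bsub>F\<^esub> v ! k) A"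

definition subspace_dim :: "'a ring \<Rightarrow> nat \<Rightarrow> 'a list set \<Rightarrow> nat" where
  "subspace_dim F n W = vectorspace.dim F (coord_space F n\<lparr>carrier := W\<rparr>)"

text \<open>The rank of a matrix with \<open>n\<close> columns is the dimension of its row space.\<close>

definition mat_rank :: "'a ring \<Rightarrow> nat \<Rightarrow> 'a list list \<Rightarrow> nat" where
  "mat_rank F n A =
    subspace_dim F n (LinearCombinations.module.span F (coord_space F n) (set A))"

definition linear_code :: "'a ring \<Rightarrow> nat \<Rightarrow> 'a list set \<Rightarrow> bool" where
  "linear_code F n C \<longleftrightarrow> VectorSpace.subspace F C (coord_space F n)"

definition redundancy :: "'a ring \<Rightarrow> nat \<Rightarrow> 'a list set \<Rightarrow> nat" where
  "redundancy F n C = n - subspace_dim F n C"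

definition parity_check_matrix ::
  "'a ring \<Rightarrow> nat \<Rightarrow> 'a list set \<Rightarrow> 'a list list \<Rightarrow> bool" where
  "parity_check_matrix F n C H \<longleftrightarrow>
    is_matrix F (redundancy F n C) n H \<and>
    mat_rank F n H = redundancy F n C \<and>
    C = {c \<in> carrier (coord_space F n). mat_vec F H c = replicate (redundancy F n C) \<zero>\<^bsub>F\<^esub>}"


section \<open>Sum-rank metric for \<open>m = 1\<close>\<close>

text \<open>\<open>ns\<close> is the list of block lengths. Applied to every row of a matrix,
  \<open>block ns i\<close> also yields the \<open>i\<close>-th block of columns.\<close>

definition block :: "nat list \<Rightarrow> nat \<Rightarrow> 'a list \<Rightarrow> 'a list" where
  "block ns i v = take (ns ! i) (drop (sum_list (take i ns)) v)"

definition block_matrix :: "nat list \<Rightarrow> nat \<Rightarrow> 'a list list \<Rightarrow> 'a list list" where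
  "block_matrix ns i H = map (block ns i) H"

definition sr_weight :: "'a ring \<Rightarrow> nat list \<Rightarrow> 'a list \<Rightarrow> nat" where
  "sr_weight F ns c = (\<Sum>i<length ns. mat_rank F (ns ! i) [block ns i c])"

text \<open>The value lies in \<open>enat\<close> so that the zero code has distance \<open>\<infinity>\<close>; for every other code the
  infimum is the minimum.\<close>

definition sr_dist :: "'a ring \<Rightarrow> nat list \<Rightarrow> 'a list set \<Rightarrow> enat" where
  "sr_dist F ns C = (INF c \<in> C - {\<zero>\<^bsub>coord_space F (sum_list ns)\<^esub>}. enat (sr_weight F ns c))"

definition proper_sr_hamming :: "'a ring \<Rightarrow> nat \<Rightarrow> nat \<Rightarrow> 'a list set \<Rightarrow> bool" where
  "proper_sr_hamming F N l C \<longleftrightarrow>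
    linear_code F (l * N) C \<and> 3 \<le> sr_dist F (replicate l N) C \<and>
    \<not> (\<exists>l' C'. l < l' \<and> linear_code F (l' * N) C' \<and> 3 \<le> sr_dist F (replicate l' N) C' \<and>
          redundancy F (l' * N) C' = redundancy F (l * N) C)"


section \<open>Computations that count field operations\<close>

text \<open>A counted computation is its result together with the number of operations in \<open>F\<close> used.
  Additions, subtractions, multiplications, inversions and zero tests cost 1 each;
  moving data and index arithmetic are free.\<close>

type_synonym 'b counted = "'b \<times> nat"

definition c_return :: "'b \<Rightarrow> 'b counted" where
  "c_return x = (x, 0)"

definition c_bind :: "'b counted \<Rightarrow> ('b \<Rightarrow> 'c counted) \<Rightarrow> 'c counted" where
  "c_bind m f = (fst (f (fst m)), snd m + snd (f (fst m)))"

adhoc_overloading Monad_Syntax.bind \<rightleftharpoons> c_bind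

definition c_add :: "'a ring \<Rightarrow> 'a \<Rightarrow> 'a \<Rightarrow> 'a counted" where
  "c_add F x y = (x \<oplus>\<^bsub>F\<^esub> y, 1)"

definition c_sub :: "'a ring \<Rightarrow> 'a \<Rightarrow> 'a \<Rightarrow> 'a counted" where
  "c_sub F x y = (x \<ominus>\<^bsub>F\<^esub> y, 1)"

definition c_mul :: "'a ring \<Rightarrow> 'a \<Rightarrow> 'a \<Rightarrow> 'a counted" where
  "c_mul F x y = (x \<otimes>\<^bsub>F\<^esub> y, 1)"

definition c_inv :: "'a ring \<Rightarrow> 'a \<Rightarrow> 'a counted" where
  "c_inv F x = (inv\<^bsub>F\<^esub> x, 1)"

definition c_is_zero :: "'a ring \<Rightarrow> 'a \<Rightarrow> bool counted" where
  "c_is_zero F x = (x = \<zero>\<^bsub>F\<^esub>, 1)"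

fun c_map :: "('b \<Rightarrow> 'c counted) \<Rightarrow> 'b list \<Rightarrow> 'c list counted" where
  "c_map f [] = c_return []"
| "c_map f (x # xs) = do { y \<leftarrow> f x; ys \<leftarrow> c_map f xs; c_return (y # ys) }"

fun c_dot :: "'a ring \<Rightarrow> 'a list \<Rightarrow> 'a list \<Rightarrow> 'a counted" where
  "c_dot F (x # xs) (y # ys) = do { p \<leftarrow> c_mul F x y; t \<leftarrow> c_dot F xs ys; c_add F p t }"
| "c_dot F _ _ = c_return \<zero>\<^bsub>F\<^esub>"

definition c_mat_vec :: "'a ring \<Rightarrow> 'a list list \<Rightarrow> 'a list \<Rightarrow> 'a list counted" where
  "c_mat_vec F A v = c_map (\<lambda>row. c_dot F row v) A"

definition c_vec_sub :: "'a ring \<Rightarrow> 'a list \<Rightarrow> 'a list \<Rightarrow> 'a list counted" where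
  "c_vec_sub F v w = c_map (\<lambda>(x, y). c_sub F x y) (zip v w)"

fun c_all_zero :: "'a ring \<Rightarrow> 'a list \<Rightarrow> bool counted" where
  "c_all_zero F [] = c_return True"
| "c_all_zero F (x # xs) =
    do { z \<leftarrow> c_is_zero F x; if z then c_all_zero F xs else c_return False }"


section \<open>Gaussian elimination\<close>

text \<open>Searches for a row with nonzero first entry; returns it together with the other rows.\<close>

fun find_pivot :: "'a ring \<Rightarrow> 'a list list \<Rightarrow> ('a list \<times> 'a list list) option counted" where
  "find_pivot F [] = c_return None"
| "find_pivot F (row # rows) = do {
     z \<leftarrow> c_is_zero F (hd row);
     if z then do {
       res \<leftarrow> find_pivot F rows;
       c_return (map_option (\<lambda>(p, rest). (p, row # rest)) res)
     } else c_return (Some (row, rows))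
   }"

text \<open>\<open>p\<close> is the pivot row, scaled to have first entry 1, without that entry.\<close>

definition eliminate_row :: "'a ring \<Rightarrow> 'a list \<Rightarrow> 'a list \<Rightarrow> 'a list counted" where
  "eliminate_row F p row =
    c_map (\<lambda>(x, y). do { t \<leftarrow> c_mul F (hd row) y; c_sub F x t }) (zip (tl row) p)"

text \<open>The rows are those of an augmented matrix with \<open>m\<close> columns of coefficients followed by the
  column of right-hand sides. The recursion descends with forward elimination and returns with
  back substitution; the unknown of a column without pivot is set to zero.\<close>

fun gauss_solve :: "'a ring \<Rightarrow> nat \<Rightarrow> 'a list list \<Rightarrow> 'a list option counted" where
  "gauss_solve F 0 rows = do {
     ok \<leftarrow> c_all_zero F (map hd rows);
     c_return (if ok then Some [] else None)
   }"
| "gauss_solve F (Suc m) rows = do {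
     pivot \<leftarrow> find_pivot F rows;
     case pivot of
       None \<Rightarrow> do {
         sol \<leftarrow> gauss_solve F m (map tl rows);
         c_return (map_option (\<lambda>x. \<zero>\<^bsub>F\<^esub> # x) sol)
       }
     | Some (prow, rest) \<Rightarrow> do {
         u \<leftarrow> c_inv F (hd prow);
         p \<leftarrow> c_map (c_mul F u) (tl prow);
         rest' \<leftarrow> c_map (eliminate_row F p) rest;
         sol \<leftarrow> gauss_solve F m rest';
         (case sol of
            None \<Rightarrow> c_return None
          | Some x \<Rightarrow> do {
              t \<leftarrow> c_dot F (butlast p) x;
              x0 \<leftarrow> c_sub F (last p) t;
              c_return (Some (x0 # x))
            })
       }
   }"

definition solve_system ::
  "'a ring \<Rightarrow> nat \<Rightarrow> 'a list list \<Rightarrow> 'a list \<Rightarrow> 'a list option counted" where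
  "solve_system F m A s = gauss_solve F m (map2 (\<lambda>row b. row @ [b]) A s)"


section \<open>The decoder\<close>

definition block_error :: "'a ring \<Rightarrow> nat list \<Rightarrow> nat \<Rightarrow> 'a list \<Rightarrow> 'a list" where
  "block_error F ns i a =
    concat (map (\<lambda>j. if j = i then a else replicate (ns ! j) \<zero>\<^bsub>F\<^esub>) [0..<length ns])"

fun try_blocks ::
  "'a ring \<Rightarrow> nat list \<Rightarrow> 'a list list \<Rightarrow> 'a list \<Rightarrow> nat list \<Rightarrow> (nat \<times> 'a list) option counted"
where
  "try_blocks F ns H s [] = c_return None"
| "try_blocks F ns H s (j # js) = do {
     sol \<leftarrow> solve_system F (ns ! j) (block_matrix ns j H) s;
     case sol of
       Some a \<Rightarrow> c_return (Some (j, a))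
     | None \<Rightarrow> try_blocks F ns H s js
   }"

text \<open>The result \<open>None\<close> means that no block admits a solution.\<close>

definition sr_decode ::
  "'a ring \<Rightarrow> nat list \<Rightarrow> 'a list list \<Rightarrow> 'a list \<Rightarrow> 'a list option counted" where
  "sr_decode F ns H y = do {
     s \<leftarrow> c_mat_vec F H y;
     z \<leftarrow> c_all_zero F s;
     if z then c_return (Some y)
     else do {
       res \<leftarrow> try_blocks F ns H s [0..<length ns];
       case res of
         None \<Rightarrow> c_return None
       | Some (i, a) \<Rightarrow> do {
           c \<leftarrow> c_vec_sub F y (block_error F ns i a);
           c_return (Some c)
         }
     }
   }"

definition decoder_output :: "'a ring \<Rightarrow> nat list \<Rightarrow> 'a list list \<Rightarrow> 'a list \<Rightarrow> 'a list option" where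
  "decoder_output F ns H y = fst (sr_decode F ns H y)"

definition decoder_ops :: "'a ring \<Rightarrow> nat list \<Rightarrow> 'a list list \<Rightarrow> 'a list \<Rightarrow> nat" where
  "decoder_ops F ns H y = snd (sr_decode F ns H y)"

end

(* Vectors of sum-rank weight at most 1 have pairwise distinct syndromes, because a difference of two
   of them has weight at most 2 and so lies in the code only if it vanishes. This gives the uniqueness
   claims and, with Gaussian elimination being sound and complete, the output. Counting the nonzero
   vectors of weight 1 by their syndromes gives sum_i (q^(n_i) - 1) <= q^r - 1. Hence n_i <= r, so
   that one elimination costs O(r^3), and l <= (q^r - 1) / (q^N - 1) for equal blocks. *)
theory Submission
  imports Defs
begin

section \<open>Cost of Gaussian elimination\<close>

text \<open>The obstacle is a mismatch of descriptions. The weight is defined through dimensions of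
  spans and syndromes through indexed field sums, whereas the decoder recurses over lists.
  \<open>mat_rank_singleton\<close> turns the weight into a count of nonzero blocks, and
  \<open>dot\<close> turns the sums into a list recursion that agrees with the result of
  \<open>c_dot\<close>. From then on everything is list algebra. Elimination must be exact in both
  directions: a solution has to be genuine, and \<open>None\<close> has to certify that a block has
  no solution, since otherwise the block that carries the error could be passed over. Hence each
  column is treated by an equivalence of solution sets, not by an implication. The zero vector has
  weight at most 1 and looks the same from every block. It is therefore excluded wherever a block
  index is to be recovered from a syndrome, both in the counting and in the uniqueness
  claims.\<close>

lemma c_simps [simp]:
  "fst (c_return x) = x" "snd (c_return x) = 0"
  "fst (c_bind m f) = fst (f (fst m))" "snd (c_bind m f) = snd m + snd (f (fst m))"
  by (simp_all add: c_return_def c_bind_def)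

lemma c_op_simps [simp]:
  "fst (c_add F x y) = x \<oplus>\<^bsub>F\<^esub> y" "snd (c_add F x y) = 1"
  "fst (c_sub F x y) = x \<ominus>\<^bsub>F\<^esub> y" "snd (c_sub F x y) = 1"
  "fst (c_mul F x y) = x \<otimes>\<^bsub>F\<^esub> y" "snd (c_mul F x y) = 1"
  "fst (c_inv F x) = inv\<^bsub>F\<^esub> x" "snd (c_inv F x) = 1"
  "fst (c_is_zero F x) \<longleftrightarrow> x = \<zero>\<^bsub>F\<^esub>" "snd (c_is_zero F x) = 1"
  by (simp_all add: c_add_def c_sub_def c_mul_def c_inv_def c_is_zero_def)

lemma fst_c_map [simp]: "fst (c_map f xs) = map (fst \<circ> f) xs"
  by (induction xs) auto

lemma snd_c_map: "snd (c_map f xs) = (\<Sum>x\<leftarrow>xs. snd (f x))"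
  by (induction xs) auto

lemma fst_c_all_zero [simp]: "fst (c_all_zero F xs) \<longleftrightarrow> set xs \<subseteq> {\<zero>\<^bsub>F\<^esub>}"
  by (induction xs) auto

lemma snd_c_all_zero: "snd (c_all_zero F xs) \<le> length xs"
  by (induction xs) auto

lemma snd_c_dot: "snd (c_dot F u v) = 2 * min (length u) (length v)"
  by (induction F u v rule: c_dot.induct) auto

lemma fst_find_pivot_None:
  "fst (find_pivot F rows) = None \<Longrightarrow> row \<in> set rows \<Longrightarrow> hd row = \<zero>\<^bsub>F\<^esub>"
  by (induction rows) (auto split: if_splits)

text \<open>The order of the rows is not tracked: \<open>solves\<close> depends on their set only.
  The length equation serves the cost bound.\<close>

lemma fst_find_pivot_Some:
  assumes "fst (find_pivot F rows) = Some (p, rest)"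
  shows "hd p \<noteq> \<zero>\<^bsub>F\<^esub>" "set rows = insert p (set rest)" "length rows = Suc (length rest)"
  using assms by (induction rows arbitrary: rest) (auto split: if_splits)

lemma snd_find_pivot: "snd (find_pivot F rows) \<le> length rows"
  by (induction rows) auto

lemma fst_eliminate_row:
  "fst (eliminate_row F p row) = map2 (\<lambda>x y. x \<ominus>\<^bsub>F\<^esub> (hd row \<otimes>\<^bsub>F\<^esub> y)) (tl row) p"
  by (auto simp: eliminate_row_def)

lemma snd_eliminate_row: "snd (eliminate_row F p row) = 2 * min (length row - 1) (length p)"
  by (simp add: eliminate_row_def snd_c_map case_prod_beta sum_list_triv)

text \<open>\<open>M\<close> and \<open>R\<close> stay fixed while the system shrinks, so that every
  column has the same budget: \<open>R\<close> for the pivot search, \<open>2 * M * R\<close> for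
  eliminating, and \<open>3 * M + 2\<close> for one inversion, scaling the pivot row and back
  substitution. The extra \<open>R\<close> pays for the final zero tests of the right-hand
  sides.\<close>

lemma snd_gauss_solve_le:
  assumes "\<forall>row\<in>set rows. length row = Suc m" "m \<le> M" "length rows \<le> R"
  shows "snd (gauss_solve F m rows) \<le> R + m * (2 * M * R + R + 3 * M + 2)"
  using assms
proof (induction m arbitrary: rows)
  case 0
  then show ?case using snd_c_all_zero[of F "map hd rows"] by simp
next
  case (Suc m)
  show ?case
  proof (cases "fst (find_pivot F rows)")
    case None
    have "snd (gauss_solve F m (map tl rows)) \<le> R + m * (2 * M * R + R + 3 * M + 2)"
      using Suc.prems by (intro Suc.IH) auto
    with None Suc.prems show ?thesis using snd_find_pivot[of F rows] by simp
  next
    case (Some pr)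
    obtain prow rest where pr: "pr = (prow, rest)" by (cases pr)
    note pivot = fst_find_pivot_Some[OF Some[unfolded pr]]
    define p where "p = map ((\<otimes>\<^bsub>F\<^esub>) (inv\<^bsub>F\<^esub> (hd prow))) (tl prow)"
    have p: "length p = Suc m" using Suc.prems(1) pivot(2) by (simp add: p_def)
    have rest: "length row = Suc (Suc m)" if "row \<in> set rest" for row
      using that Suc.prems(1) pivot(2) by simp
    define rest' where "rest' = map (fst \<circ> eliminate_row F p) rest"
    define sol where "sol = gauss_solve F m rest'"
    have sol: "snd sol \<le> R + m * (2 * M * R + R + 3 * M + 2)"
      unfolding sol_def using Suc.prems pivot(3) rest p
      by (intro Suc.IH) (auto simp: rest'_def fst_eliminate_row)
    \<comment> \<open>Each of the \<open>Suc m\<close> entries behind the leading one costs a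
      multiplication and a subtraction.\<close>
    have "(\<Sum>row\<leftarrow>rest. snd (eliminate_row F p row)) = (\<Sum>row\<leftarrow>rest. 2 * Suc m)"
      using rest p by (intro arg_cong[where f = sum_list] map_cong) (auto simp: snd_eliminate_row)
    also have "\<dots> = length rest * (2 * Suc m)" by (simp only: sum_list_triv of_nat_id)
    also have "\<dots> \<le> R * (2 * M)" using Suc.prems pivot(3) by (intro mult_le_mono) auto
    also have "\<dots> = 2 * M * R" by simp
    finally have elim: "(\<Sum>row\<leftarrow>rest. snd (eliminate_row F p row)) \<le> 2 * M * R" .
    have dot: "snd (c_dot F (butlast p) x) \<le> 2 * m" for x
      using p by (simp add: snd_c_dot)
    have "snd (gauss_solve F (Suc m) rows) = snd (find_pivot F rows) + 1 + length (tl prow)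
      + (\<Sum>row\<leftarrow>rest. snd (eliminate_row F p row)) + snd sol
      + (case fst sol of None \<Rightarrow> 0 | Some x \<Rightarrow> snd (c_dot F (butlast p) x) + 1)"
      by (simp add: Some pr snd_c_map sum_list_triv sol_def rest'_def p_def comp_def split: option.split)
    also have "\<dots> \<le> length rows + 1 + Suc m + 2 * M * R + snd sol + (2 * m + 1)"
    proof (intro add_mono order.refl elim snd_find_pivot)
      show "length (tl prow) \<le> Suc m" using p by (simp add: p_def)
      show "(case fst sol of None \<Rightarrow> 0 | Some x \<Rightarrow> snd (c_dot F (butlast p) x) + 1) \<le> 2 * m + 1"
        using dot by (simp split: option.split)
    qed
    also have "\<dots> \<le> R + Suc m * (2 * M * R + R + 3 * M + 2)"
      using sol Suc.prems by simp
    finally show ?thesis .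
  qed
qed

section \<open>Correctness of Gaussian elimination\<close>

locale coord_field = field F for F :: "'a ring" (structure)
begin

section \<open>Dot products as a list recursion\<close>

lemma carrier_coord_space: "carrier (coord_space F n) = {v. length v = n \<and> set v \<subseteq> carrier F}"
  by (simp add: coord_space_def)

lemma carrier_coord_space_nth:
  "v \<in> carrier (coord_space F n) \<longleftrightarrow> length v = n \<and> (\<forall>i<n. v ! i \<in> carrier F)"
  using all_set_conv_all_nth[of v "\<lambda>x. x \<in> carrier F"] by (auto simp: carrier_coord_space)

lemma zero_in_coord_space [simp]: "replicate n \<zero> \<in> carrier (coord_space F n)"
  by (auto simp: carrier_coord_space)

text \<open>The pattern of \<open>c_dot\<close>, including the truncation to the shorter list, so
  that results of the program are values of \<open>dot\<close> without any side condition.\<close>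

fun dot :: "'a list \<Rightarrow> 'a list \<Rightarrow> 'a" where
  "dot (x # xs) (y # ys) = x \<otimes> y \<oplus> dot xs ys"
| "dot _ _ = \<zero>"

lemma fst_c_dot [simp]: "fst (c_dot F u v) = dot u v"
  by (induction u v rule: dot.induct) auto

lemma dot_closed [simp]: "set u \<subseteq> carrier F \<Longrightarrow> set v \<subseteq> carrier F \<Longrightarrow> dot u v \<in> carrier F"
  by (induction u v rule: dot.induct) auto

lemma finsum_eq_dot:
  assumes "length u = length v" "set u \<subseteq> carrier F" "set v \<subseteq> carrier F"
  shows "(\<Oplus>k\<in>{..<length v}. u ! k \<otimes> v ! k) = dot u v"
  using assms
proof (induction u v rule: list_induct2)
  case (Cons x xs y ys)
  have nth: "xs ! k \<otimes> ys ! k \<in> carrier F" if "k < length ys" for k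
  proof -
    have "xs ! k \<in> set xs" "ys ! k \<in> set ys" using that Cons.hyps by simp_all
    then show ?thesis using Cons.prems by auto
  qed
  have "(\<Oplus>k\<in>{..<length (y # ys)}. (x # xs) ! k \<otimes> (y # ys) ! k)
    = x \<otimes> y \<oplus> (\<Oplus>k\<in>Suc ` {..<length ys}. (x # xs) ! k \<otimes> (y # ys) ! k)"
    using Cons.prems nth by (simp add: lessThan_Suc_eq_insert_0) (subst finsum_insert, auto)
  also have "(\<Oplus>k\<in>Suc ` {..<length ys}. (x # xs) ! k \<otimes> (y # ys) ! k) = (\<Oplus>k\<in>{..<length ys}. xs ! k \<otimes> ys ! k)"
    using nth by (subst finsum_reindex) auto
  finally show ?case using Cons by simp
qed simp

lemma mat_vec_eq_dot:
  assumes "is_matrix F r n A" "v \<in> carrier (coord_space F n)"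
  shows "mat_vec F A v = map (\<lambda>row. dot row v) A"
  using assms by (auto simp: mat_vec_def is_matrix_def carrier_coord_space intro!: finsum_eq_dot)

lemma dot_append:
  assumes "length u = length v" "set u \<subseteq> carrier F" "set v \<subseteq> carrier F"
    "set u' \<subseteq> carrier F" "set v' \<subseteq> carrier F"
  shows "dot (u @ u') (v @ v') = dot u v \<oplus> dot u' v'"
  using assms by (induction u v rule: list_induct2) (auto simp: a_assoc)

lemma dot_replicate_zero: "set u \<subseteq> carrier F \<Longrightarrow> dot u (replicate n \<zero>) = \<zero>"
proof (induction u arbitrary: n)
  case (Cons x u)
  then show ?case by (cases n) auto
qed simp

lemma dot_minus_right:
  assumes "length u = length v" "length v = length w"
    "set u \<subseteq> carrier F" "set v \<subseteq> carrier F" "set w \<subseteq> carrier F"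
  shows "dot u (map2 (\<lambda>x y. x \<ominus> y) v w) = dot u v \<ominus> dot u w"
  using assms
proof (induction u v w rule: list_induct3)
  case (Cons x xs y ys z zs)
  have c: "dot xs ys \<in> carrier F" "dot xs zs \<in> carrier F" "x \<in> carrier F" "y \<in> carrier F" "z \<in> carrier F"
    using Cons.prems by auto
  have "x \<otimes> (y \<ominus> z) \<oplus> (dot xs ys \<ominus> dot xs zs) = x \<otimes> y \<oplus> dot xs ys \<ominus> (x \<otimes> z \<oplus> dot xs zs)"
    using c by algebra
  then show ?case using Cons by simp
qed (simp add: a_minus_def)

lemma dot_minus_smult_left:
  assumes "length u = length v" "length v = length w" "h \<in> carrier F"
    "set u \<subseteq> carrier F" "set v \<subseteq> carrier F" "set w \<subseteq> carrier F"
  shows "dot (map2 (\<lambda>x y. x \<ominus> h \<otimes> y) u v) w = dot u w \<ominus> h \<otimes> dot v w"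
  using assms
proof (induction u v w rule: list_induct3)
  case (Cons x xs y ys z zs)
  have c: "dot xs zs \<in> carrier F" "dot ys zs \<in> carrier F" "x \<in> carrier F" "y \<in> carrier F" "z \<in> carrier F"
    using Cons.prems by auto
  have "(x \<ominus> h \<otimes> y) \<otimes> z \<oplus> (dot xs zs \<ominus> h \<otimes> dot ys zs)
    = x \<otimes> z \<oplus> dot xs zs \<ominus> h \<otimes> (y \<otimes> z \<oplus> dot ys zs)"
    using c \<open>h \<in> carrier F\<close> by algebra
  then show ?case using Cons by simp
qed (simp add: a_minus_def)

lemma dot_smult_left:
  assumes "length u = length v" "h \<in> carrier F" "set u \<subseteq> carrier F" "set v \<subseteq> carrier F"
  shows "dot (map ((\<otimes>) h) u) v = h \<otimes> dot u v"
  using assms by (induction u v rule: list_induct2) (auto simp: m_assoc r_distr)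

text \<open>Separates the right-hand side of an augmented row, its last entry, from the
  coefficients; applied with \<open>y = \<ominus> \<one>\<close>.\<close>

lemma dot_snoc:
  assumes "length p = Suc (length x)" "set p \<subseteq> carrier F" "set x \<subseteq> carrier F" "y \<in> carrier F"
  shows "dot p (x @ [y]) = dot (butlast p) x \<oplus> last p \<otimes> y"
proof -
  have "p = butlast p @ [last p]" using assms(1) by (metis append_butlast_last_id list.size(3) nat.distinct(1))
  moreover from this have "set (butlast p) \<subseteq> carrier F" "last p \<in> carrier F"
    using assms(2) by (auto dest: in_set_butlastD) (metis assms(2) last_in_set list.size(3) nat.distinct(1) assms(1) subsetD)
  ultimately show ?thesis
    using assms dot_append[of "butlast p" x "[last p]" "[y]"] by simp
qed

text \<open>A row of an augmented matrix holds iff it annihilates the unknowns followed by \<open>-1\<close>; thus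
  elimination acts on a homogeneous system.\<close>

definition solves :: "'a list list \<Rightarrow> 'a list \<Rightarrow> bool" where
  "solves rows x \<longleftrightarrow> (\<forall>row\<in>set rows. dot row (x @ [\<ominus> \<one>]) = \<zero>)"

text \<open>Put \<open>z = x @ [\<ominus> \<one>]\<close> and let \<open>h\<close> be the pivot
  entry. The pivot row evaluates to \<open>h \<otimes> (x0 \<oplus> dot p z)\<close>, and
  \<open>h\<close> is invertible, so it holds iff \<open>x0 = \<ominus> dot p z\<close>.
  Substituting this value into any other row gives exactly the eliminated row.\<close>

lemma solves_pivot:
  assumes rows: "\<forall>row\<in>insert prow (set rest). length row = Suc (Suc m) \<and> set row \<subseteq> carrier F"
    and pivot: "hd prow \<noteq> \<zero>"
    and x: "x0 \<in> carrier F" "x \<in> carrier (coord_space F m)"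
    and p: "p = map ((\<otimes>) (inv (hd prow))) (tl prow)"
  shows "solves (prow # rest) (x0 # x) \<longleftrightarrow>
    x0 = last p \<ominus> dot (butlast p) x \<and> solves (map (fst \<circ> eliminate_row F p) rest) x"
proof -
  define z where "z = x @ [\<ominus> \<one>]"
  have z: "length z = Suc m" "set z \<subseteq> carrier F" using x by (auto simp: z_def carrier_coord_space)
  obtain h t where prow: "prow = h # t" using rows by (cases prow) auto
  have ht: "h \<in> carrier F" "set t \<subseteq> carrier F" "length t = Suc m" "h \<noteq> \<zero>"
    using rows pivot prow by auto
  have u: "inv h \<in> carrier F" "inv h \<otimes> h = \<one>" "h \<otimes> inv h = \<one>" using ht by (auto simp: field_Units)
  have pl: "length p = Suc m" "set p \<subseteq> carrier F" using ht u by (auto simp: p prow)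
  have pz: "dot p z = inv h \<otimes> dot t z" using ht u z by (simp add: p prow dot_smult_left)
  have tz: "dot t z \<in> carrier F" "dot p z \<in> carrier F" using ht z pl by auto
  have "dot prow (x0 # z) = h \<otimes> (x0 \<oplus> dot p z)"
  proof -
    have "h \<otimes> (x0 \<oplus> inv h \<otimes> dot t z) = h \<otimes> x0 \<oplus> (h \<otimes> inv h) \<otimes> dot t z"
      using ht(1) u(1) x(1) tz(1) by algebra
    then show ?thesis using u tz by (simp add: prow pz)
  qed
  moreover have "h \<otimes> (x0 \<oplus> dot p z) = \<zero> \<longleftrightarrow> x0 \<oplus> dot p z = \<zero>"
    using ht tz x by (simp add: integral_iff)
  moreover have "x0 \<oplus> dot p z = \<zero> \<longleftrightarrow> x0 = \<ominus> dot p z"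
    using tz x by (metis minus_equality r_neg a_comm a_inv_closed)
  moreover have "\<ominus> dot p z = last p \<ominus> dot (butlast p) x"
  proof -
    have c: "dot (butlast p) x \<in> carrier F" "last p \<in> carrier F"
      using pl x by (auto simp: carrier_coord_space dest: in_set_butlastD intro!: dot_closed)
        (metis last_in_set length_0_conv nat.distinct(1) subsetD)
    have "dot p z = dot (butlast p) x \<oplus> last p \<otimes> \<ominus> \<one>"
      unfolding z_def using pl x by (intro dot_snoc) (auto simp: carrier_coord_space)
    moreover have "\<ominus> (dot (butlast p) x \<oplus> last p \<otimes> \<ominus> \<one>) = last p \<ominus> dot (butlast p) x"
      using c by algebra
    ultimately show ?thesis by simp
  qed
  ultimately have first: "dot prow (x0 # z) = \<zero> \<longleftrightarrow> x0 = last p \<ominus> dot (butlast p) x"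
    "x0 = last p \<ominus> dot (butlast p) x \<longleftrightarrow> x0 = \<ominus> dot p z"
    by simp_all
  \<comment> \<open>The equality is valid only for the value of \<open>x0\<close> that the pivot row
    forces; this is why the lemma keeps that equation as a conjunct.\<close>
  have rest: "dot row (x0 # z) = dot (fst (eliminate_row F p row)) z"
    if row: "row \<in> set rest" and x0: "x0 = \<ominus> dot p z" for row
  proof -
    obtain k s where ks: "row = k # s" using rows row by (cases row) auto
    have "length row = Suc (Suc m) \<and> set row \<subseteq> carrier F" using rows row by blast
    then have s: "k \<in> carrier F" "set s \<subseteq> carrier F" "length s = Suc m" by (simp_all add: ks)
    have "dot s z \<in> carrier F" using s z by simp
    then have "k \<otimes> \<ominus> dot p z \<oplus> dot s z = dot s z \<ominus> k \<otimes> dot p z"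
      using s tz by algebra
    then show ?thesis using s z pl by (simp add: ks x0 fst_eliminate_row dot_minus_smult_left)
  qed
  show ?thesis
    using first rest by (auto simp: solves_def z_def)
qed

text \<open>Induction on the number of unknowns. With or without a pivot, \<open>solves\<close> for
  the first unknown and the rest is expressed by \<open>solves\<close> of a system in the rest,
  which transfers success and failure alike.\<close>

lemma gauss_solve_correct:
  assumes "\<forall>row\<in>set rows. length row = Suc m \<and> set row \<subseteq> carrier F"
  shows "case fst (gauss_solve F m rows) of
      None \<Rightarrow> \<forall>x\<in>carrier (coord_space F m). \<not> solves rows x
    | Some x \<Rightarrow> x \<in> carrier (coord_space F m) \<and> solves rows x"
  using assms
proof (induction m arbitrary: rows)
  case 0
  have "dot row [\<ominus> \<one>] = \<zero> \<longleftrightarrow> hd row = \<zero>" if "row \<in> set rows" for row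
  proof -
    have "length row = Suc 0 \<and> set row \<subseteq> carrier F" using 0 that by blast
    then obtain b where b: "row = [b]" "b \<in> carrier F" by (cases row) auto
    have "b \<otimes> \<ominus> \<one> = \<ominus> b" using b(2) by algebra
    then show ?thesis using b by (simp add: add.inv_eq_1_iff)
  qed
  then show ?case by (auto simp: carrier_coord_space solves_def)
next
  case (Suc m)
  show ?case
  proof (cases "fst (find_pivot F rows)")
    case None
    have IH: "case fst (gauss_solve F m (map tl rows)) of
      None \<Rightarrow> \<forall>x\<in>carrier (coord_space F m). \<not> solves (map tl rows) x
    | Some x \<Rightarrow> x \<in> carrier (coord_space F m) \<and> solves (map tl rows) x"
    proof (intro Suc.IH ballI)
      fix row' assume "row' \<in> set (map tl rows)"
      then obtain row where row: "row \<in> set rows" "row' = tl row" by auto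
      then have "length row = Suc (Suc m) \<and> set row \<subseteq> carrier F" using Suc.prems by blast
      then show "length row' = Suc m \<and> set row' \<subseteq> carrier F" using row(2) by (cases row) auto
    qed
    \<comment> \<open>All leading entries are zero, so the first unknown is free. Allowing every
      \<open>x0\<close>, and not just the zero that the program picks, is what makes failure
      conclusive.\<close>
    have eq: "solves rows (x0 # x) \<longleftrightarrow> solves (map tl rows) x"
      if "x0 \<in> carrier F" "x \<in> carrier (coord_space F m)" for x0 x
    proof -
      have "dot row (x0 # x @ [\<ominus> \<one>]) = dot (tl row) (x @ [\<ominus> \<one>])" if row: "row \<in> set rows" for row
      proof -
        obtain s where s: "row = \<zero> # s"
          using fst_find_pivot_None[OF None row] Suc.prems row by (cases row) auto
        have "set row \<subseteq> carrier F" using Suc.prems row by blast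
        then have "set s \<subseteq> carrier F" by (simp add: s)
        then show ?thesis
          using s \<open>x0 \<in> carrier F\<close> \<open>x \<in> carrier (coord_space F m)\<close> by (simp add: carrier_coord_space)
      qed
      then show ?thesis by (simp add: solves_def)
    qed
    show ?thesis
    proof (cases "fst (gauss_solve F m (map tl rows))")
      case None': None
      have "\<not> solves rows x" if x: "x \<in> carrier (coord_space F (Suc m))" for x
      proof -
        obtain x0 x' where "x = x0 # x'" "x0 \<in> carrier F" "x' \<in> carrier (coord_space F m)"
          using x by (cases x) (auto simp: carrier_coord_space)
        then show ?thesis using IH eq None' by simp
      qed
      then show ?thesis by (simp add: None None')
    next
      case (Some x)
      then have "x \<in> carrier (coord_space F m)" "solves (map tl rows) x" using IH by simp_all
      then show ?thesis using eq Some by (simp add: None) (simp add: carrier_coord_space)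
    qed
  next
    case (Some pr)
    obtain prow rest where pr: "pr = (prow, rest)" by (cases pr)
    note pivot = fst_find_pivot_Some[OF Some[unfolded pr]]
    define p where "p = map ((\<otimes>) (inv (hd prow))) (tl prow)"
    define rest' where "rest' = map (fst \<circ> eliminate_row F p) rest"
    have rows: "\<forall>row\<in>insert prow (set rest). length row = Suc (Suc m) \<and> set row \<subseteq> carrier F"
      using Suc.prems pivot(2) by simp
    have eq: "solves rows (x0 # x) \<longleftrightarrow> x0 = last p \<ominus> dot (butlast p) x \<and> solves rest' x"
      if "x0 \<in> carrier F" "x \<in> carrier (coord_space F m)" for x0 x
      using solves_pivot[OF rows pivot(1) that p_def] pivot(2) by (simp add: solves_def rest'_def)
    have "hd prow \<in> carrier F" "set (tl prow) \<subseteq> carrier F" "length (tl prow) = Suc m"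
      using rows by (cases prow; simp)+
    then have p: "length p = Suc m" "set p \<subseteq> carrier F"
      using pivot(1) by (auto simp: p_def field_Units)
    have rest': "\<forall>row\<in>set rest'. length row = Suc m \<and> set row \<subseteq> carrier F"
    proof
      fix row' assume "row' \<in> set rest'"
      then obtain row where row: "row \<in> set rest" "row' = fst (eliminate_row F p row)"
        by (auto simp: rest'_def)
      have "length row = Suc (Suc m) \<and> set row \<subseteq> carrier F" using rows row by blast
      then obtain k t where t: "row = k # t" "k \<in> carrier F" "length t = Suc m" "set t \<subseteq> carrier F"
        by (cases row) auto
      then show "length row' = Suc m \<and> set row' \<subseteq> carrier F"
        using row p by (auto simp: fst_eliminate_row elim!: in_set_zipE)
    qed
    have closed: "last p \<ominus> dot (butlast p) x \<in> carrier F" if "x \<in> carrier (coord_space F m)" for x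
    proof -
      have "last p \<in> carrier F" "set (butlast p) \<subseteq> carrier F"
        using p by (auto dest: in_set_butlastD) (metis last_in_set length_0_conv nat.distinct(1) subsetD)
      then show ?thesis using that by (simp add: carrier_coord_space)
    qed
    have gauss: "fst (gauss_solve F (Suc m) rows) =
      map_option (\<lambda>x. (last p \<ominus> dot (butlast p) x) # x) (fst (gauss_solve F m rest'))"
      by (simp add: Some pr p_def rest'_def comp_def split: option.split)
    show ?thesis
    proof (cases "fst (gauss_solve F m rest')")
      case None
      have "\<not> solves rows x" if x: "x \<in> carrier (coord_space F (Suc m))" for x
      proof -
        obtain x0 x' where "x = x0 # x'" "x0 \<in> carrier F" "x' \<in> carrier (coord_space F m)"
          using x by (cases x) (auto simp: carrier_coord_space)
        then show ?thesis using Suc.IH[OF rest'] eq None by simp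
      qed
      then show ?thesis by (simp add: gauss None del: gauss_solve.simps)
    next
      case (Some x)
      then have "x \<in> carrier (coord_space F m)" "solves rest' x" using Suc.IH[OF rest'] by simp_all
      then show ?thesis
        using eq[OF closed] closed Some by (simp add: gauss del: gauss_solve.simps) (simp add: carrier_coord_space)
    qed
  qed
qed


lemma solve_system_correct:
  assumes A: "is_matrix F r m A" and s: "s \<in> carrier (coord_space F r)"
  shows "case fst (solve_system F m A s) of
      None \<Rightarrow> \<forall>x\<in>carrier (coord_space F m). mat_vec F A x \<noteq> s
    | Some x \<Rightarrow> x \<in> carrier (coord_space F m) \<and> mat_vec F A x = s"
proof -
  define rows where "rows = map2 (\<lambda>row b. row @ [b]) A s"
  have len: "length A = r" "length s = r"
    and A_nth: "\<And>i. i < r \<Longrightarrow> length (A ! i) = m \<and> set (A ! i) \<subseteq> carrier F"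
    and s_nth: "\<And>i. i < r \<Longrightarrow> s ! i \<in> carrier F"
    using A s by (auto simp: is_matrix_def carrier_coord_space_nth[of s])
      (auto simp: carrier_coord_space dest!: nth_mem)
  have rows: "\<forall>row\<in>set rows. length row = Suc m \<and> set row \<subseteq> carrier F"
    using A_nth s_nth len by (auto simp: rows_def all_set_conv_all_nth)
  have "solves rows x \<longleftrightarrow> mat_vec F A x = s" if x: "x \<in> carrier (coord_space F m)" for x
  proof -
    have "dot (A ! i @ [s ! i]) (x @ [\<ominus> \<one>]) = \<zero> \<longleftrightarrow> dot (A ! i) x = s ! i" if "i < r" for i
    proof -
      have c: "dot (A ! i) x \<in> carrier F" "s ! i \<in> carrier F"
        using A_nth s_nth x that by (simp_all add: carrier_coord_space)
      have "dot (A ! i @ [s ! i]) (x @ [\<ominus> \<one>]) = dot (A ! i) x \<oplus> s ! i \<otimes> \<ominus> \<one>"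
        using A_nth s_nth x that by (simp add: dot_append carrier_coord_space)
      also have "\<dots> = dot (A ! i) x \<ominus> s ! i" using c by algebra
      finally show ?thesis using c by simp
    qed
    then show ?thesis
      using len by (auto simp: mat_vec_eq_dot[OF A x] solves_def rows_def all_set_conv_all_nth list_eq_iff_nth_eq)
  qed
  with gauss_solve_correct[OF rows] show ?thesis
    by (auto simp: solve_system_def rows_def split: option.splits)
qed

section \<open>Blocks and the sum-rank weight\<close>

lemma vectorspace_coord_space: "vectorspace F (coord_space F n)"
proof -
  let ?V = "coord_space F n"
  have ops: "v \<oplus>\<^bsub>?V\<^esub> w = map2 (\<lambda>x y. x \<oplus> y) v w" "\<zero>\<^bsub>?V\<^esub> = replicate n \<zero>"
    "a \<odot>\<^bsub>?V\<^esub> v = map (\<lambda>x. a \<otimes> x) v" for a v w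
    by (simp_all add: coord_space_def)
  note V = carrier_coord_space_nth ops list_eq_iff_nth_eq
  have "abelian_group ?V"
  proof (rule abelian_groupI)
    fix u v w assume "u \<in> carrier ?V" "v \<in> carrier ?V" "w \<in> carrier ?V"
    then show "(u \<oplus>\<^bsub>?V\<^esub> v) \<oplus>\<^bsub>?V\<^esub> w = u \<oplus>\<^bsub>?V\<^esub> (v \<oplus>\<^bsub>?V\<^esub> w)" by (simp add: V a_assoc)
  next
    fix u v assume "u \<in> carrier ?V" "v \<in> carrier ?V"
    then show "u \<oplus>\<^bsub>?V\<^esub> v = v \<oplus>\<^bsub>?V\<^esub> u" by (simp add: V a_comm)
  next
    fix v assume v: "v \<in> carrier ?V"
    show "\<exists>w\<in>carrier ?V. w \<oplus>\<^bsub>?V\<^esub> v = \<zero>\<^bsub>?V\<^esub>"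
      using v by (intro bexI[of _ "map (\<lambda>x. \<ominus> x) v"]) (simp_all add: V l_neg)
  qed (simp_all add: V)
  then have "Module.module F ?V"
    by (intro moduleI) (simp_all add: V is_cring l_distr r_distr m_assoc)
  then show ?thesis by (simp add: vectorspace_def field_axioms)
qed

text \<open>The row space is the line through \<open>v\<close>, or zero. The dimension is that of
  the span as a space of its own, so \<open>v\<close> must be shown to span it from inside.\<close>

lemma mat_rank_singleton:
  assumes v: "v \<in> carrier (coord_space F n)"
  shows "mat_rank F n [v] = (if v = replicate n \<zero> then 0 else 1)"
proof -
  interpret V: vectorspace F "coord_space F n" by (rule vectorspace_coord_space)
  let ?W = "V.span {v}"
  interpret W: vectorspace F "V.vs ?W" using v by (intro V.subspace_is_vs V.span_is_subspace) simp
  have vW: "v \<in> ?W" using V.in_own_span[of "{v}"] v by simp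
  have gen: "W.span {v} = carrier (V.vs ?W)"
    using V.span_li_not_depend(1)[of "{v}" ?W] V.span_is_submodule[of "{v}"] v vW by simp
  have zero: "\<zero>\<^bsub>V.vs ?W\<^esub> = replicate n \<zero>" by (simp add: coord_space_def)
  have rank: "mat_rank F n [v] = W.dim" by (simp add: mat_rank_def subspace_dim_def)
  show ?thesis
  proof (cases "v = replicate n \<zero>")
    case True
    then have "W.dim = 0" using gen zero by (intro W.dim0I) simp
    then show ?thesis using rank True by simp
  next
    case False
    then have "W.dim = 1" using gen zero vW by (intro W.dim1I[of v]) simp_all
    then show ?thesis using rank False by simp
  qed
qed

section \<open>Splitting vectors into blocks and embedding a single block\<close>

lemma block_Cons_0 [simp]: "block (n # ns) 0 v = take n v"
  by (simp add: block_def)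

lemma block_Cons_Suc [simp]: "block (n # ns) (Suc i) v = block ns i (drop n v)"
  by (simp add: block_def add.commute)

lemma length_block [simp]:
  "i < length ns \<Longrightarrow> length v = sum_list ns \<Longrightarrow> length (block ns i v) = ns ! i"
  by (induction ns arbitrary: i v) (auto simp: less_Suc_eq_0_disj)

lemma set_block_subset: "set (block ns i v) \<subseteq> set v"
  unfolding block_def by (meson order.trans set_drop_subset set_take_subset)

lemma block_in_coord_space [simp]:
  "i < length ns \<Longrightarrow> v \<in> carrier (coord_space F (sum_list ns)) \<Longrightarrow>
    block ns i v \<in> carrier (coord_space F (ns ! i))"
  using set_block_subset[of ns i v] by (auto simp: carrier_coord_space)

lemma block_map2: "block ns i (map2 f u v) = map2 f (block ns i u) (block ns i v)"
  by (simp add: block_def take_map drop_map take_zip drop_zip)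

lemma block_replicate:
  "i < length ns \<Longrightarrow> block ns i (replicate (sum_list ns) x) = replicate (ns ! i) x"
  by (induction ns arbitrary: i) (auto simp: less_Suc_eq_0_disj)

lemma blocks_eqI:
  assumes "length u = sum_list ns" "length v = sum_list ns"
    and "\<And>i. i < length ns \<Longrightarrow> block ns i u = block ns i v"
  shows "u = v"
  using assms
proof (induction ns arbitrary: u v)
  case (Cons n ns)
  have "take n u = take n v" using Cons.prems(3)[of 0] by simp
  moreover have "drop n u = drop n v"
  proof (rule Cons.IH)
    show "block ns i (drop n u) = block ns i (drop n v)" if "i < length ns" for i
      using Cons.prems(3)[of "Suc i"] that by simp
  qed (use Cons.prems in auto)
  ultimately show ?case by (metis append_take_drop_id)
qed simp

text \<open>An index that is never met is a device for \<open>block_error_Cons_0\<close>: the blocks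
  behind the first form a block error with index \<open>length ns\<close>, hence are zero.\<close>

lemma block_error_out_of_range:
  "length ns \<le> i \<Longrightarrow> block_error F ns i a = replicate (sum_list ns) \<zero>"
proof (induction ns arbitrary: i)
  case (Cons n ns)
  from Cons.prems obtain k where k: "i = Suc k" by (cases i) auto
  have "block_error F (n # ns) (Suc k) a = replicate n \<zero> @ block_error F ns k a"
    by (simp add: block_error_def map_upt_Suc comp_def del: upt_Suc cong: if_cong)
  then show ?case using Cons k by (simp add: replicate_add)
qed (simp add: block_error_def)

lemma block_error_Cons_Suc:
  "block_error F (n # ns) (Suc i) a = replicate n \<zero> @ block_error F ns i a"
  by (simp add: block_error_def map_upt_Suc comp_def del: upt_Suc cong: if_cong)

lemma block_error_Cons_0: "block_error F (n # ns) 0 a = a @ replicate (sum_list ns) \<zero>"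
proof -
  have "block_error F (n # ns) 0 a = a @ block_error F ns (length ns) a"
    by (auto simp: block_error_def map_upt_Suc comp_def simp del: upt_Suc cong: if_cong intro!: arg_cong[where f = concat])
  then show ?thesis by (simp add: block_error_out_of_range)
qed

lemma block_error_in_coord_space:
  assumes "i < length ns" "a \<in> carrier (coord_space F (ns ! i))"
  shows "block_error F ns i a \<in> carrier (coord_space F (sum_list ns))"
  using assms
proof (induction ns arbitrary: i)
  case (Cons n ns)
  then show ?case
    by (cases i) (auto simp: carrier_coord_space block_error_Cons_0 block_error_Cons_Suc)
qed simp

lemma block_block_error:
  assumes "i < length ns" "j < length ns" "length a = ns ! i"
  shows "block ns j (block_error F ns i a) = (if j = i then a else replicate (ns ! j) \<zero>)"
  using assms
proof (induction ns arbitrary: i j)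
  case (Cons n ns)
  then show ?case
    by (cases i; cases j) (simp_all add: block_error_Cons_0 block_error_Cons_Suc block_replicate)
qed simp

lemma dot_block_error:
  assumes "i < length ns" "row \<in> carrier (coord_space F (sum_list ns))"
    "a \<in> carrier (coord_space F (ns ! i))"
  shows "dot row (block_error F ns i a) = dot (block ns i row) a"
  using assms
proof (induction ns arbitrary: i row)
  case (Cons n ns)
  have row: "length (take n row) = n" "set (take n row) \<subseteq> carrier F"
    "drop n row \<in> carrier (coord_space F (sum_list ns))"
    using Cons.prems(2) by (auto simp: carrier_coord_space dest: in_set_takeD in_set_dropD)
  have split: "dot row (u @ w) = dot (take n row) u \<oplus> dot (drop n row) w"
    if "u \<in> carrier (coord_space F n)" "set w \<subseteq> carrier F" for u w
    using dot_append[of "take n row" u "drop n row" w] row that by (simp add: carrier_coord_space)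
  show ?case
  proof (cases i)
    case 0
    have "set (replicate (sum_list ns) \<zero>) \<subseteq> carrier F" by auto
    then show ?thesis
      using 0 Cons.prems row split
      by (simp add: block_error_Cons_0 dot_replicate_zero carrier_coord_space)
  next
    case (Suc k)
    have "block_error F ns k a \<in> carrier (coord_space F (sum_list ns))"
      using Cons.prems Suc by (intro block_error_in_coord_space) simp_all
    then have w: "set (block_error F ns k a) \<subseteq> carrier F" by (simp add: carrier_coord_space)
    note z = zero_in_coord_space[of n]
    have "set (block ns k (drop n row)) \<subseteq> carrier F" "set a \<subseteq> carrier F"
      using block_in_coord_space[of k ns "drop n row"] Cons.prems row Suc by (auto simp: carrier_coord_space)
    then have "dot (block ns k (drop n row)) a \<in> carrier F" by simp
    then show ?thesis
      using Cons.IH[of k "drop n row"] Cons.prems row Suc split[OF z w]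
      by (simp add: block_error_Cons_Suc dot_replicate_zero)
  qed
qed simp

lemma is_matrix_block_matrix:
  assumes "is_matrix F r (sum_list ns) H" "i < length ns"
  shows "is_matrix F r (ns ! i) (block_matrix ns i H)"
proof -
  have "block ns i row \<in> carrier (coord_space F (ns ! i))" if "row \<in> set H" for row
    using assms(1) that unfolding is_matrix_def by (intro block_in_coord_space assms(2)) blast
  then show ?thesis using assms(1) by (simp add: is_matrix_def block_matrix_def image_subset_iff)
qed

text \<open>The bridge from the algorithm to the code: solving the system of block \<open>i\<close>
  amounts to finding an error confined to that block with the given syndrome.\<close>

lemma mat_vec_block_error:
  assumes "is_matrix F r (sum_list ns) H" "i < length ns" "a \<in> carrier (coord_space F (ns ! i))"
  shows "mat_vec F H (block_error F ns i a) = mat_vec F (block_matrix ns i H) a"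
proof -
  have "row \<in> carrier (coord_space F (sum_list ns))" if "row \<in> set H" for row
    using assms(1) that by (auto simp: is_matrix_def)
  then show ?thesis
    using assms mat_vec_eq_dot[OF assms(1) block_error_in_coord_space[OF assms(2,3)]]
      mat_vec_eq_dot[OF is_matrix_block_matrix[OF assms(1,2)] assms(3)]
    by (simp add: block_matrix_def dot_block_error)
qed

section \<open>Weight as the number of nonzero blocks\<close>

lemma sr_weight_eq_card:
  assumes "v \<in> carrier (coord_space F (sum_list ns))"
  shows "sr_weight F ns v = card {i. i < length ns \<and> block ns i v \<noteq> replicate (ns ! i) \<zero>}"
proof -
  have "sr_weight F ns v = (\<Sum>i<length ns. if block ns i v \<noteq> replicate (ns ! i) \<zero> then 1 else 0)"
    unfolding sr_weight_def using assms by (intro sum.cong) (auto simp: mat_rank_singleton)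
  also have "\<dots> = card {i \<in> {..<length ns}. block ns i v \<noteq> replicate (ns ! i) \<zero>}"
    by (subst sum.inter_filter[symmetric]) simp_all
  finally show ?thesis by simp
qed

lemma minus_in_coord_space:
  "u \<in> carrier (coord_space F n) \<Longrightarrow> v \<in> carrier (coord_space F n) \<Longrightarrow>
    map2 (\<lambda>x y. x \<ominus> y) u v \<in> carrier (coord_space F n)"
  by (simp add: carrier_coord_space_nth)

lemma minus_eq_zero_iff:
  assumes "u \<in> carrier (coord_space F n)" "v \<in> carrier (coord_space F n)"
  shows "map2 (\<lambda>x y. x \<ominus> y) u v = replicate n \<zero> \<longleftrightarrow> u = v"
proof -
  have "u ! i \<ominus> v ! i = \<zero> \<longleftrightarrow> u ! i = v ! i" if "i < n" for i
    using assms that by (simp add: carrier_coord_space_nth)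
  then show ?thesis using assms by (simp add: carrier_coord_space list_eq_iff_nth_eq)
qed

lemma sr_weight_minus_le:
  assumes "u \<in> carrier (coord_space F (sum_list ns))" "v \<in> carrier (coord_space F (sum_list ns))"
  shows "sr_weight F ns (map2 (\<lambda>x y. x \<ominus> y) u v) \<le> sr_weight F ns u + sr_weight F ns v"
proof -
  let ?supp = "\<lambda>v. {i. i < length ns \<and> block ns i v \<noteq> replicate (ns ! i) \<zero>}"
  have "?supp (map2 (\<lambda>x y. x \<ominus> y) u v) \<subseteq> ?supp u \<union> ?supp v"
    using assms by (auto simp: block_map2 minus_eq_zero_iff[OF block_in_coord_space block_in_coord_space])
  then have "card (?supp (map2 (\<lambda>x y. x \<ominus> y) u v)) \<le> card (?supp u \<union> ?supp v)"
    by (intro card_mono) auto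
  also have "\<dots> \<le> card (?supp u) + card (?supp v)" by (rule card_Un_le)
  finally show ?thesis using assms by (simp add: sr_weight_eq_card minus_in_coord_space)
qed

lemma sr_weight_block_error_le:
  assumes "i < length ns" "a \<in> carrier (coord_space F (ns ! i))"
  shows "sr_weight F ns (block_error F ns i a) \<le> 1"
proof -
  have "{j. j < length ns \<and> block ns j (block_error F ns i a) \<noteq> replicate (ns ! j) \<zero>} \<subseteq> {i}"
    using assms by (auto simp: block_block_error carrier_coord_space split: if_splits)
  from card_mono[OF _ this] show ?thesis
    using assms by (simp add: sr_weight_eq_card block_error_in_coord_space)
qed

lemma sr_weight_le_1E:
  assumes "v \<in> carrier (coord_space F (sum_list ns))" "sr_weight F ns v \<le> 1" "ns \<noteq> []"
  obtains i where "i < length ns" "v = block_error F ns i (block ns i v)"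
proof -
  let ?supp = "{i. i < length ns \<and> block ns i v \<noteq> replicate (ns ! i) \<zero>}"
  obtain i where i: "i < length ns" "?supp \<subseteq> {i}"
  \<comment> \<open>The zero vector is an error in any block; block 0 is chosen, which exists
    because \<open>ns\<close> is nonempty.\<close>
  proof (cases "?supp = {}")
    case True
    moreover have "0 < length ns" using assms(3) by simp
    ultimately show ?thesis using that by blast
  next
    case False
    then obtain i where "i \<in> ?supp" by blast
    moreover have "finite ?supp" "card ?supp \<le> Suc 0"
      using assms by (simp_all add: sr_weight_eq_card)
    ultimately have "?supp \<subseteq> {i}" by (auto simp: card_le_Suc0_iff_eq)
    then show ?thesis using that \<open>i \<in> ?supp\<close> by blast
  qed
  have b: "block ns i v \<in> carrier (coord_space F (ns ! i))" using assms i by simp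
  have "v = block_error F ns i (block ns i v)"
  proof (rule blocks_eqI)
    show "block ns j v = block ns j (block_error F ns i (block ns i v))" if "j < length ns" for j
      using i b that by (auto simp: block_block_error carrier_coord_space)
  qed (use assms b block_error_in_coord_space[OF i(1) b] in \<open>simp_all add: carrier_coord_space\<close>)
  with i(1) show ?thesis by (rule that)
qed

lemma mat_vec_minus:
  assumes "is_matrix F r n A" "u \<in> carrier (coord_space F n)" "v \<in> carrier (coord_space F n)"
  shows "mat_vec F A (map2 (\<lambda>x y. x \<ominus> y) u v)
    = map2 (\<lambda>x y. x \<ominus> y) (mat_vec F A u) (mat_vec F A v)"
proof -
  have "dot row (map2 (\<lambda>x y. x \<ominus> y) u v) = dot row u \<ominus> dot row v" if "row \<in> set A" for row
    using assms that by (intro dot_minus_right) (auto simp: is_matrix_def carrier_coord_space)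
  then show ?thesis
    using assms by (auto simp: mat_vec_eq_dot minus_in_coord_space zip_map1 zip_map2 zip_same_conv_map)
qed

lemma mat_vec_in_coord_space:
  assumes "is_matrix F r n A" "v \<in> carrier (coord_space F n)"
  shows "mat_vec F A v \<in> carrier (coord_space F r)"
proof -
  have "dot row v \<in> carrier F" if "row \<in> set A" for row
    using assms that by (intro dot_closed) (auto simp: is_matrix_def carrier_coord_space)
  then show ?thesis
    using assms by (auto simp: mat_vec_eq_dot) (auto simp: is_matrix_def carrier_coord_space)
qed

lemma card_coord_space: "finite (carrier F) \<Longrightarrow> card (carrier (coord_space F n)) = card (carrier F) ^ n"
  using card_lists_length_eq[of "carrier F" n] by (simp add: carrier_coord_space conj_commute)

lemma finite_coord_space: "finite (carrier F) \<Longrightarrow> finite (carrier (coord_space F n))"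
  using finite_lists_length_eq[of "carrier F" n] by (simp add: carrier_coord_space conj_commute)

lemma card_carrier_ge_2: "finite (carrier F) \<Longrightarrow> 2 \<le> card (carrier F)"
  using card_mono[of "carrier F" "{\<zero>, \<one>}"] by simp

lemma try_blocks_correct:
  assumes "is_matrix F r (sum_list ns) H" "s \<in> carrier (coord_space F r)"
    and "\<And>j. j \<in> set js \<Longrightarrow> j < length ns"
  shows "case fst (try_blocks F ns H s js) of
      None \<Rightarrow> \<forall>j\<in>set js. \<forall>a\<in>carrier (coord_space F (ns ! j)). mat_vec F (block_matrix ns j H) a \<noteq> s
    | Some (i, a) \<Rightarrow> i \<in> set js \<and> a \<in> carrier (coord_space F (ns ! i)) \<and>
        mat_vec F (block_matrix ns i H) a = s"
  using assms(3)
proof (induction js)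
  case (Cons j js)
  have j: "j < length ns" using Cons.prems by simp
  note IH = Cons.IH[OF Cons.prems[OF list.set_intros(2)]]
  show ?case
    using solve_system_correct[OF is_matrix_block_matrix[OF assms(1) j] assms(2)] IH
    by (auto split: option.splits)
qed simp

end

section \<open>Decoding\<close>

text \<open>The code enters as the kernel of \<open>H\<close>, the form in which its minimum
  distance becomes injectivity of the syndrome on errors of weight at most 1.\<close>

locale sr_code = coord_field F for F :: "'a ring" (structure) +
  fixes ns :: "nat list" and C H r
  assumes finite_field: "finite (carrier F)"
    and ns: "ns \<noteq> []" "\<forall>m\<in>set ns. 0 < m"
    and dist: "3 \<le> sr_dist F ns C"
    and H: "is_matrix F r (sum_list ns) H"
    and kernel: "C = {c \<in> carrier (coord_space F (sum_list ns)). mat_vec F H c = replicate r \<zero>}"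
begin

abbreviation "n \<equiv> sum_list ns"

section \<open>Distinct syndromes and the counting bound\<close>

lemma syndrome_inj:
  assumes u: "u \<in> carrier (coord_space F n)" "sr_weight F ns u \<le> 1"
    and v: "v \<in> carrier (coord_space F n)" "sr_weight F ns v \<le> 1"
    and eq: "mat_vec F H u = mat_vec F H v"
  shows "u = v"
proof -
  define d where "d = map2 (\<lambda>x y. x \<ominus> y) u v"
  have d: "d \<in> carrier (coord_space F n)" using u v by (simp add: d_def minus_in_coord_space)
  have "mat_vec F H d = replicate r \<zero>"
    using H u v mat_vec_in_coord_space[OF H] by (simp add: d_def mat_vec_minus minus_eq_zero_iff eq)
  then have "d \<in> C" using d kernel by simp
  have "d = replicate n \<zero>"
  proof (rule ccontr)
    assume "d \<noteq> replicate n \<zero>"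
    then have "sr_dist F ns C \<le> enat (sr_weight F ns d)"
      using \<open>d \<in> C\<close> unfolding sr_dist_def by (intro INF_lower) (simp add: coord_space_def)
    then have "3 \<le> enat (sr_weight F ns d)" using dist by (rule order.trans[rotated])
    then have "3 \<le> sr_weight F ns d" by (simp add: numeral_eq_enat)
    moreover have "sr_weight F ns d \<le> 2"
      using sr_weight_minus_le[OF u(1) v(1)] u(2) v(2) unfolding d_def by linarith
    ultimately show False by simp
  qed
  then show "u = v" using u v by (simp add: d_def minus_eq_zero_iff)
qed

lemma mat_vec_block_matrix_replicate_zero:
  assumes "i < length ns"
  shows "mat_vec F (block_matrix ns i H) (replicate (ns ! i) \<zero>) = replicate r \<zero>"
proof -
  note z = zero_in_coord_space[of "ns ! i"]
  note B = is_matrix_block_matrix[OF H assms]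
  then have "set row \<subseteq> carrier F" if "row \<in> set (block_matrix ns i H)" for row
    using that by (auto simp: is_matrix_def carrier_coord_space)
  then show ?thesis
    using B by (simp add: mat_vec_eq_dot[OF B z] dot_replicate_zero map_replicate_const is_matrix_def
        cong: map_cong)
qed

text \<open>Both block vectors are embedded as full-length errors, which \<open>syndrome_inj\<close>
  identifies. Reading off block \<open>i\<close> gives \<open>a = b\<close>, or \<open>a\<close>
  zero if the blocks differ; \<open>nz\<close> excludes the latter.\<close>

lemma block_syndrome_inj:
  assumes i: "i < length ns" "a \<in> carrier (coord_space F (ns ! i))"
    and j: "j < length ns" "b \<in> carrier (coord_space F (ns ! j))"
    and eq: "mat_vec F (block_matrix ns i H) a = mat_vec F (block_matrix ns j H) b"
    and nz: "a \<noteq> replicate (ns ! i) \<zero>"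
  shows "i = j \<and> a = b"
proof -
  have "block_error F ns i a = block_error F ns j b"
  proof (rule syndrome_inj)
    show "mat_vec F H (block_error F ns i a) = mat_vec F H (block_error F ns j b)"
      using i j eq by (simp add: mat_vec_block_error[OF H])
  qed (use i j in \<open>simp_all only: block_error_in_coord_space sr_weight_block_error_le\<close>)
  then have "block ns i (block_error F ns i a) = block ns i (block_error F ns j b)"
    by (rule arg_cong)
  then have "a = (if i = j then b else replicate (ns ! i) \<zero>)"
    using i j by (simp only: block_block_error carrier_coord_space mem_Collect_eq if_True simp_thms)
  then show ?thesis using nz by (cases "i = j") simp_all
qed

text \<open>The pairs of a block index and a nonzero vector for that block inject into the nonzero
  syndromes.\<close>

lemma sum_nonzero_blocks_le:
  "(\<Sum>i<length ns. card (carrier F) ^ (ns ! i) - 1) \<le> card (carrier F) ^ r - 1"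
proof -
  let ?V = "\<lambda>m. carrier (coord_space F m) - {replicate m \<zero>}"
  have card_V: "card (?V m) = card (carrier F) ^ m - 1" "finite (?V m)" for m
    using finite_field
    by (simp_all add: card_coord_space finite_coord_space)
  have "card (SIGMA i:{..<length ns}. ?V (ns ! i)) \<le> card (?V r)"
  proof (rule card_inj_on_le)
    show "inj_on (\<lambda>(i, a). mat_vec F (block_matrix ns i H) a) (SIGMA i:{..<length ns}. ?V (ns ! i))"
      using block_syndrome_inj by (auto simp: inj_on_def)
    show "(\<lambda>(i, a). mat_vec F (block_matrix ns i H) a) ` (SIGMA i:{..<length ns}. ?V (ns ! i)) \<subseteq> ?V r"
    proof (rule image_subsetI)
      fix x assume "x \<in> (SIGMA i:{..<length ns}. ?V (ns ! i))"
      then obtain i a where x: "x = (i, a)" and i: "i < length ns"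
        and a: "a \<in> carrier (coord_space F (ns ! i))" "a \<noteq> replicate (ns ! i) \<zero>" by blast
      \<comment> \<open>Compare \<open>a\<close> with the zero vector of the same block: equal
        syndromes would force \<open>a\<close> to vanish.\<close>
      have "mat_vec F (block_matrix ns i H) a \<noteq> replicate r \<zero>"
      proof
        assume "mat_vec F (block_matrix ns i H) a = replicate r \<zero>"
        then have "a = replicate (ns ! i) \<zero>"
          using block_syndrome_inj[OF i a(1) i _ _ a(2)] mat_vec_block_matrix_replicate_zero[OF i] by simp
        with a(2) show False ..
      qed
      then show "(case x of (i, a) \<Rightarrow> mat_vec F (block_matrix ns i H) a) \<in> ?V r"
        using mat_vec_in_coord_space[OF is_matrix_block_matrix[OF H i] a(1)] by (simp add: x)
    qed
  qed (rule card_V)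
  then show ?thesis by (subst (asm) card_SigmaI) (simp_all add: card_V finite_coord_space[OF finite_field])
qed

lemma block_length_le:
  assumes "i < length ns"
  shows "ns ! i \<le> r"
proof -
  have "card (carrier F) ^ (ns ! i) - 1 \<le> (\<Sum>i<length ns. card (carrier F) ^ (ns ! i) - 1)"
    using assms by (intro member_le_sum) auto
  then have "card (carrier F) ^ (ns ! i) - 1 \<le> card (carrier F) ^ r - 1"
    using sum_nonzero_blocks_le by linarith
  \<comment> \<open>Positivity rules out truncation on the right, so the subtracted ones
    cancel.\<close>
  moreover have "0 < card (carrier F) ^ r" using card_carrier_ge_2[OF finite_field] by simp
  ultimately have "card (carrier F) ^ (ns ! i) \<le> card (carrier F) ^ r" by linarith
  then show ?thesis using card_carrier_ge_2[OF finite_field] by (simp add: power_le_imp_le_exp)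
qed

text \<open>Used in the cost bounds to absorb \<open>r\<close> and \<open>n\<close> into
  \<open>n * r\<close>, and lower powers of \<open>r\<close> into \<open>r ^ 3\<close>.\<close>

lemma length_pos: "0 < n" "0 < r"
proof -
  have "0 < ns ! 0" "0 < length ns" using ns by simp_all
  then show "0 < r" using block_length_le[of 0] by linarith
  show "0 < n" using \<open>0 < ns ! 0\<close> \<open>0 < length ns\<close> elem_le_sum_list[of 0 ns] by linarith
qed

lemma snd_try_blocks_le:
  assumes "length s = r" "\<And>j. j \<in> set js \<Longrightarrow> j < length ns"
  shows "snd (try_blocks F ns H s js) \<le> length js * (9 * r ^ 3)"
  using assms(2)
proof (induction js)
  case (Cons j js)
  have j: "j < length ns" using Cons.prems by simp
  let ?A = "block_matrix ns j H"
  have A: "length ?A = r" "\<forall>row\<in>set ?A. length row = ns ! j"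
    using is_matrix_block_matrix[OF H j] by (auto simp: is_matrix_def carrier_coord_space)
  \<comment> \<open>The elimination bound with \<open>M = R = r\<close>: there are \<open>r\<close>
    equations, and at most \<open>r\<close> unknowns by \<open>block_length_le\<close>.\<close>
  have "snd (solve_system F (ns ! j) ?A s) \<le> r + ns ! j * (2 * r * r + r + 3 * r + 2)"
    unfolding solve_system_def using A assms(1) block_length_le[OF j]
    by (intro snd_gauss_solve_le) (auto dest!: set_zip_leftD)
  also have "\<dots> \<le> r + r * (2 * r * r + r + 3 * r + 2)"
    using block_length_le[OF j] by (intro add_left_mono mult_right_mono) simp_all
  also have "\<dots> = 2 * r ^ 3 + 4 * r ^ 2 + 3 * r" by (simp add: algebra_simps power2_eq_square power3_eq_cube)
  \<comment> \<open>Source of the constant 9, as 2 + 4 + 3; raising the exponents relies on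
    \<open>r\<close> being positive.\<close>
  also have "\<dots> \<le> 2 * r ^ 3 + 4 * r ^ 3 + 3 * r ^ 3"
    using length_pos(2) power_increasing[of 2 3 r] power_increasing[of 1 3 r]
    by (intro add_mono) simp_all
  finally have "snd (solve_system F (ns ! j) ?A s) \<le> 9 * r ^ 3" by simp
  moreover have "snd (try_blocks F ns H s js) \<le> length js * (9 * r ^ 3)"
    using Cons by simp
  ultimately show ?case by (simp split: option.split)
qed simp

lemma fst_c_mat_vec:
  assumes "v \<in> carrier (coord_space F n)"
  shows "fst (c_mat_vec F H v) = mat_vec F H v"
  by (simp only: c_mat_vec_def mat_vec_eq_dot[OF H assms] fst_c_map comp_def fst_c_dot)

lemma snd_c_mat_vec:
  assumes "v \<in> carrier (coord_space F n)"
  shows "snd (c_mat_vec F H v) = 2 * (n * r)"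
proof -
  have "snd (c_mat_vec F H v) = (\<Sum>row\<leftarrow>H. 2 * n)"
    unfolding c_mat_vec_def snd_c_map using H assms
    by (intro arg_cong[where f = sum_list] map_cong) (auto simp: snd_c_dot is_matrix_def carrier_coord_space)
  then show ?thesis using H by (simp add: sum_list_triv is_matrix_def)
qed

lemma decoder_ops_le:
  assumes y: "y \<in> carrier (coord_space F n)"
  shows "decoder_ops F ns H y \<le> 9 * (n * r + length ns * r ^ 3)"
proof -
  define s where "s = mat_vec F H y"
  have s: "length s = r" using mat_vec_in_coord_space[OF H y] by (simp add: s_def carrier_coord_space)
  have sub: "snd (c_vec_sub F y w) \<le> n" for w
    using y by (simp add: c_vec_sub_def snd_c_map case_prod_beta sum_list_triv carrier_coord_space)
  have "decoder_ops F ns H y \<le> 2 * (n * r) + (r + (length ns * (9 * r ^ 3) + n))"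
    using snd_c_all_zero[of F s] snd_try_blocks_le[OF s, of "[0..<length ns]"] sub s
    by (auto simp: decoder_ops_def sr_decode_def fst_c_mat_vec[OF y] snd_c_mat_vec[OF y] add_mono
        simp flip: s_def split: option.split)
  \<comment> \<open>Syndrome, zero test and final subtraction together cost at most
    \<open>4 * (n * r)\<close>, so the constant 9 of the eliminations covers them.\<close>
  moreover have "r \<le> n * r" "n \<le> n * r" using length_pos by simp_all
  moreover have "length ns * (9 * r ^ 3) = 9 * (length ns * r ^ 3)" by (rule mult.left_commute)
  ultimately show ?thesis unfolding distrib_left by linarith
qed

text \<open>Whichever block yields a solution, the error built from it has the syndrome of
  \<open>e\<close> and weight at most 1, so it is \<open>e\<close> itself.\<close>

lemma error_unique:
  assumes e: "e \<in> carrier (coord_space F n)" "sr_weight F ns e \<le> 1"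
    and a: "i < length ns" "a \<in> carrier (coord_space F (ns ! i))"
      "mat_vec F (block_matrix ns i H) a = mat_vec F H e"
  shows "block_error F ns i a = e"
proof (rule syndrome_inj)
  show "mat_vec F H (block_error F ns i a) = mat_vec F H e"
    using a by (simp add: mat_vec_block_error[OF H])
qed (use e a in \<open>simp_all only: block_error_in_coord_space sr_weight_block_error_le\<close>)

section \<open>Decoding a received word\<close>

context
  fixes c e y s
  assumes c: "c \<in> C" and e: "e \<in> carrier (coord_space F n)" "sr_weight F ns e \<le> 1"
    and y: "y = c \<oplus>\<^bsub>coord_space F n\<^esub> e" and s: "s = mat_vec F H y"
begin

lemma codeword_in_coord_space: "c \<in> carrier (coord_space F n)"
  using c kernel by simp

lemma received_in_coord_space: "y \<in> carrier (coord_space F n)"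
  using codeword_in_coord_space e(1) unfolding y
  by (simp add: carrier_coord_space_nth) (simp add: coord_space_def)

lemma received_minus_error: "map2 (\<lambda>x y. x \<ominus> y) y e = c"
proof (rule nth_equalityI)
  fix i assume "i < length (map2 (\<lambda>x y. x \<ominus> y) y e)"
  then have i: "i < n" using e(1) by (simp add: carrier_coord_space)
  have ce: "c ! i \<in> carrier F" "e ! i \<in> carrier F"
    using codeword_in_coord_space e(1) i by (simp_all add: carrier_coord_space_nth)
  have "y ! i = c ! i \<oplus> e ! i"
    using codeword_in_coord_space e(1) i unfolding y carrier_coord_space by (simp add: coord_space_def)
  moreover have "(c ! i \<oplus> e ! i) \<ominus> e ! i = c ! i" using ce by algebra
  ultimately show "map2 (\<lambda>x y. x \<ominus> y) y e ! i = c ! i"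
    using i e(1) received_in_coord_space by (simp add: carrier_coord_space)
qed (use codeword_in_coord_space e(1) received_in_coord_space in \<open>simp add: carrier_coord_space\<close>)

lemma syndrome_eq: "s = mat_vec F H e"
proof -
  have se: "s \<in> carrier (coord_space F r)" "mat_vec F H e \<in> carrier (coord_space F r)"
    using mat_vec_in_coord_space[OF H] received_in_coord_space e(1) s by simp_all
  have "map2 (\<lambda>x y. x \<ominus> y) s (mat_vec F H e) = mat_vec F H c"
    using mat_vec_minus[OF H received_in_coord_space e(1)] by (simp add: received_minus_error s)
  also have "\<dots> = replicate r \<zero>" using c kernel by simp
  finally show ?thesis using se by (simp add: minus_eq_zero_iff)
qed

lemma error_block_exists:
  "\<exists>i<length ns. \<exists>a\<in>carrier (coord_space F (ns ! i)). mat_vec F (block_matrix ns i H) a = s"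
proof -
  obtain i where i: "i < length ns" "e = block_error F ns i (block ns i e)"
    using sr_weight_le_1E[OF e ns(1)] by blast
  then have "mat_vec F (block_matrix ns i H) (block ns i e) = s"
    using mat_vec_block_error[OF H i(1), of "block ns i e"] e(1) syndrome_eq by simp
  with i(1) e(1) show ?thesis
    by (intro exI[of _ i] conjI bexI[of _ "block ns i e"]) simp_all
qed

text \<open>Provides the nonzero vector that \<open>block_syndrome_inj\<close> asks for in the two
  uniqueness claims.\<close>

lemma nonzero_solution:
  assumes "s \<noteq> replicate r \<zero>" "i < length ns" "mat_vec F (block_matrix ns i H) a = s"
  shows "a \<noteq> replicate (ns ! i) \<zero>"
proof
  assume "a = replicate (ns ! i) \<zero>"
  then have "s = replicate r \<zero>" using assms(2,3) mat_vec_block_matrix_replicate_zero by simp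
  with assms(1) show False ..
qed

lemma error_block_unique:
  assumes "s \<noteq> replicate r \<zero>"
  shows "\<exists>!i. i < length ns \<and>
    (\<exists>a\<in>carrier (coord_space F (ns ! i)). mat_vec F (block_matrix ns i H) a = s)"
proof -
  obtain i a where i: "i < length ns" "a \<in> carrier (coord_space F (ns ! i))"
    "mat_vec F (block_matrix ns i H) a = s"
    using error_block_exists by blast
  have "j = i" if "j < length ns" "b \<in> carrier (coord_space F (ns ! j))"
    "mat_vec F (block_matrix ns j H) b = s" for j b
    using block_syndrome_inj[OF that(1,2) i(1,2)] nonzero_solution[OF assms that(1,3)] that(3) i(3)
    by simp
  with i show ?thesis by blast
qed

lemma error_value_unique:
  assumes "s \<noteq> replicate r \<zero>" "i < length ns"
    "\<exists>a\<in>carrier (coord_space F (ns ! i)). mat_vec F (block_matrix ns i H) a = s"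
  shows "\<exists>!a. a \<in> carrier (coord_space F (ns ! i)) \<and> mat_vec F (block_matrix ns i H) a = s"
proof -
  obtain a where a: "a \<in> carrier (coord_space F (ns ! i))" "mat_vec F (block_matrix ns i H) a = s"
    using assms(3) by blast
  have "b = a" if "b \<in> carrier (coord_space F (ns ! i))" "mat_vec F (block_matrix ns i H) b = s" for b
    using block_syndrome_inj[OF assms(2) that(1) assms(2) a(1)]
      nonzero_solution[OF assms(1,2) that(2)] that(2) a(2) by simp
  with a show ?thesis by blast
qed

lemma fst_c_mat_vec_received: "fst (c_mat_vec F H y) = s"
  by (simp only: fst_c_mat_vec[OF received_in_coord_space] s)

lemma decoder_output_eq: "decoder_output F ns H y = Some c"
proof (cases "s = replicate r \<zero>")
  case True
  \<comment> \<open>The zero vector and \<open>e\<close> both have weight at most 1 and syndrome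
    zero, so nothing was corrupted and returning \<open>y\<close> is right.\<close>
  have "replicate n \<zero> = e"
  proof (rule syndrome_inj)
    note z = zero_in_coord_space[of n]
    show "replicate n \<zero> \<in> carrier (coord_space F n)" by simp
    show "sr_weight F ns (replicate n \<zero>) \<le> 1"
      by (simp add: sr_weight_eq_card block_replicate cong: conj_cong)
    have "set row \<subseteq> carrier F" if "row \<in> set H" for row
      using H that by (auto simp: is_matrix_def carrier_coord_space)
    then show "mat_vec F H (replicate n \<zero>) = mat_vec F H e"
      using H by (simp add: mat_vec_eq_dot[OF H z] dot_replicate_zero map_replicate_const is_matrix_def
          True flip: syndrome_eq cong: map_cong)
  qed (fact e)+
  then have "y = map2 (\<lambda>x y. x \<oplus> y) c (replicate n \<zero>)" by (simp add: y coord_space_def)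
  then have "y = c"
    using codeword_in_coord_space by (simp add: carrier_coord_space_nth list_eq_iff_nth_eq)
  have "set s \<subseteq> {\<zero>}" using True by auto
  then have "decoder_output F ns H y = Some y"
    by (simp add: decoder_output_def sr_decode_def fst_c_mat_vec_received)
  with \<open>y = c\<close> show ?thesis by simp
next
  case False
  have sr: "s \<in> carrier (coord_space F r)"
    using mat_vec_in_coord_space[OF H received_in_coord_space] s by simp
  have nonzero: "\<not> set s \<subseteq> {\<zero>}"
  proof
    assume "set s \<subseteq> {\<zero>}"
    then have "s = replicate (length s) \<zero>" by (intro replicate_length_same[symmetric]) blast
    with False sr show False by (simp add: carrier_coord_space)
  qed
  note correct = try_blocks_correct[OF H sr, of "[0..<length ns]"]
  \<comment> \<open>Completeness of elimination enters here: failure on all blocks would contradict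
    the solution supplied by \<open>e\<close> itself.\<close>
  have "fst (try_blocks F ns H s [0..<length ns]) \<noteq> None"
  proof
    assume "fst (try_blocks F ns H s [0..<length ns]) = None"
    then have "\<forall>j\<in>{0..<length ns}. \<forall>a\<in>carrier (coord_space F (ns ! j)).
        mat_vec F (block_matrix ns j H) a \<noteq> s"
      using correct by simp
    with error_block_exists show False by (meson atLeastLessThan_iff zero_le)
  qed
  then obtain i a where ia: "fst (try_blocks F ns H s [0..<length ns]) = Some (i, a)"
    by (metis not_Some_eq surj_pair)
  then have i: "i < length ns" and a: "a \<in> carrier (coord_space F (ns ! i))"
    "mat_vec F (block_matrix ns i H) a = s"
    using correct by simp_all
  have "block_error F ns i a = e"
    using error_unique[OF e i a(1)] a(2) syndrome_eq by simp
  moreover have "fst (c_vec_sub F y e) = c"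
  proof -
    have "fst \<circ> (\<lambda>(x, y). c_sub F x y) = (\<lambda>(x, y). x \<ominus> y)" by auto
    then show ?thesis using received_minus_error by (simp add: c_vec_sub_def)
  qed
  ultimately show ?thesis
    by (simp add: decoder_output_def sr_decode_def fst_c_mat_vec_received nonzero ia)
qed

end

lemma decoder_ops_le_equal_blocks:
  assumes y: "y \<in> carrier (coord_space F n)" and N: "ns = replicate l N"
  shows "real (decoder_ops F ns H y) \<le>
    9 * ((real r ^ 3 + real N * real r) * ((real (card (carrier F)) ^ r - 1) / (real (card (carrier F)) ^ N - 1)))"
proof -
  let ?q = "card (carrier F)"
  have q: "2 \<le> ?q" by (rule card_carrier_ge_2[OF finite_field])
  have "N \<in> set ns" using ns(1) by (cases l) (simp_all add: N)
  then have "0 < N" using ns(2) by blast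
  then have qN: "1 < real ?q ^ N" using q by (intro one_less_power) auto
  have "l * (?q ^ N - 1) \<le> ?q ^ r - 1"
    using sum_nonzero_blocks_le by (simp add: N)
  then have "real (l * (?q ^ N - 1)) \<le> real (?q ^ r - 1)" by (simp only: of_nat_le_iff)
  then have "real l * (real ?q ^ N - 1) \<le> real ?q ^ r - 1"
    using q by (simp add: of_nat_diff)
  then have l: "real l \<le> (real ?q ^ r - 1) / (real ?q ^ N - 1)"
    using qN by (simp add: pos_le_divide_eq)
  have "real (decoder_ops F ns H y) \<le> real (9 * (n * r + length ns * r ^ 3))"
    using decoder_ops_le[OF y] by (simp only: of_nat_le_iff)
  \<comment> \<open>With equal blocks the length is \<open>l * N\<close>, so \<open>l\<close>
    factors out of both terms and only its bound remains to be inserted.\<close>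
  also have "\<dots> = 9 * ((real r ^ 3 + real N * real r) * real l)"
    by (simp add: N sum_list_replicate algebra_simps)
  also have "\<dots> \<le> 9 * ((real r ^ 3 + real N * real r) * ((real ?q ^ r - 1) / (real ?q ^ N - 1)))"
    using l by (intro mult_left_mono) auto
  finally show ?thesis .
qed

end

theorem mainTheorem7:
  "\<exists>K1 K2 :: real.
    \<forall>(F :: 'a ring) q ns l n C r H c e y s.
      field F \<and> finite (carrier F) \<and> q = card (carrier F) \<and>
      ns \<noteq> [] \<and> (\<forall>m \<in> set ns. 0 < m) \<and> l = length ns \<and> n = sum_list ns \<and>
      linear_code F n C \<and> 3 \<le> sr_dist F ns C \<and> r = redundancy F n C \<and>
      parity_check_matrix F n C H \<and>
      c \<in> C \<and> e \<in> carrier (coord_space F n) \<and> sr_weight F ns e \<le> 1 \<and>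
      y = c \<oplus>\<^bsub>coord_space F n\<^esub> e \<and> s = mat_vec F H y
      \<longrightarrow>
      (s \<noteq> replicate r \<zero>\<^bsub>F\<^esub> \<longrightarrow>
        (\<exists>!i. i < l \<and> (\<exists>a \<in> carrier (coord_space F (ns ! i)). mat_vec F (block_matrix ns i H) a = s)) \<and>
        (\<forall>i < l. (\<exists>a \<in> carrier (coord_space F (ns ! i)). mat_vec F (block_matrix ns i H) a = s) \<longrightarrow>
          (\<exists>!a. a \<in> carrier (coord_space F (ns ! i)) \<and> mat_vec F (block_matrix ns i H) a = s))) \<and>
      decoder_output F ns H y = Some c \<and>
      real (decoder_ops F ns H y) \<le> K1 * (real n * real r + real l * real r ^ 3) \<and>
      (\<forall>N. ns = replicate l N \<and> N dvd r \<and> proper_sr_hamming F N l C \<longrightarrow>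
        real (decoder_ops F ns H y) \<le>
          K2 * ((real r ^ 3 + real N * real r) * ((real q ^ r - 1) / (real q ^ N - 1))))"
proof (intro exI allI impI)
  fix F :: "'a ring" and q ns l n C r H c e y s
  assume A: "field F \<and> finite (carrier F) \<and> q = card (carrier F) \<and>
      ns \<noteq> [] \<and> (\<forall>m \<in> set ns. 0 < m) \<and> l = length ns \<and> n = sum_list ns \<and>
      linear_code F n C \<and> 3 \<le> sr_dist F ns C \<and> r = redundancy F n C \<and>
      parity_check_matrix F n C H \<and>
      c \<in> C \<and> e \<in> carrier (coord_space F n) \<and> sr_weight F ns e \<le> 1 \<and>
      y = c \<oplus>\<^bsub>coord_space F n\<^esub> e \<and> s = mat_vec F H y"
  then have eqs: "q = card (carrier F)" "l = length ns" "n = sum_list ns" by simp_all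
  interpret field F using A by simp
  interpret sr_code F ns C H r
    using A unfolding parity_check_matrix_def by (elim conjE, unfold_locales) simp_all
  have prems: "c \<in> C" "e \<in> carrier (coord_space F (sum_list ns))" "sr_weight F ns e \<le> 1"
    "y = c \<oplus>\<^bsub>coord_space F (sum_list ns)\<^esub> e" "s = mat_vec F H y"
    using A by (elim conjE; simp)+
  note y = received_in_coord_space[OF prems]
  have ops: "real (decoder_ops F ns H y) \<le> real (9 * (sum_list ns * r + length ns * r ^ 3))"
    using decoder_ops_le[OF y] by (simp only: of_nat_le_iff)
  \<comment> \<open>The witnesses left open by \<open>exI\<close> are fixed here. Both are 9, from
    \<open>decoder_ops_le\<close> and \<open>decoder_ops_le_equal_blocks\<close>.\<close>
  show "(s \<noteq> replicate r \<zero>\<^bsub>F\<^esub> \<longrightarrow>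
        (\<exists>!i. i < l \<and> (\<exists>a \<in> carrier (coord_space F (ns ! i)). mat_vec F (block_matrix ns i H) a = s)) \<and>
        (\<forall>i < l. (\<exists>a \<in> carrier (coord_space F (ns ! i)). mat_vec F (block_matrix ns i H) a = s) \<longrightarrow>
          (\<exists>!a. a \<in> carrier (coord_space F (ns ! i)) \<and> mat_vec F (block_matrix ns i H) a = s))) \<and>
      decoder_output F ns H y = Some c \<and>
      real (decoder_ops F ns H y) \<le> 9 * (real n * real r + real l * real r ^ 3) \<and>
      (\<forall>N. ns = replicate l N \<and> N dvd r \<and> proper_sr_hamming F N l C \<longrightarrow>
        real (decoder_ops F ns H y) \<le>
          9 * ((real r ^ 3 + real N * real r) * ((real q ^ r - 1) / (real q ^ N - 1))))"
    unfolding eqs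
  proof (intro conjI impI allI)
    show "real (decoder_ops F ns H y) \<le> 9 * (real (sum_list ns) * real r + real (length ns) * real r ^ 3)"
      using ops by simp
  qed (use error_block_unique[OF prems] error_value_unique[OF prems] decoder_output_eq[OF prems]
      decoder_ops_le_equal_blocks[OF y] in blast)+
qed

end
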